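(* Let $G=(V,E)$, $G_1=(V_1,E_1)$ and $G_2=(V_2,E_2)$ be graphs such that $G$ is a $t$-sum of $G_1,G_2$ along an edge $e$ for some $2\leq t\leq d+1$. Suppose $G$ is an $\mathcal{R}_d$-circuit. Then, for both $i=1,2$, $G_i$ contains a unique $\mathcal{R}_d$-circuit $G_i'$ with $e\in E(G_i')$ and $E(G)=(E(G_1')\cup E(G_2'))-e$.
   Context: Here $d\geq 1$ is an integer and all graphs are finite and simple. $G$ is a $t$-sum of $G_1,G_2$ along an edge $e$ if $G=(G_1\cup G_2)-e$, $G_1\cap G_2=K_t$ (the intersection of the two graphs is a complete graph on $t$ vertices) and $e\in E_1\cap E_2$. For a graph $G=(V,E)$ and $p:V\to\mathbb{R}^d$, the rigidity matrix $R(G,p)$ is the $|E|\times d|V|$ matrix in which, for each edge $e=v_iv_j$, row $e$ has $p(v_i)-p(v_j)$ in the $d$ columns of $v_i$, $p(v_j)-p(v_i)$ in the $d$ columns of $v_j$, and zeros elsewhere. A realisation $p$ is generic if its $d|V|$ coordinates are algebraically independent over $\mathbb{Q}$. The $d$-dimensional rigidity matroid $\mathcal{R}_d(G)$ is the matroid on $E$ in which $F\subseteq E$ is independent if the corresponding rows of $R(G,p)$ are linearly independent for some (equivalently every) generic $p$. $G$ is $\mathcal{R}_d$-independent if $E$ is independent in $\mathcal{R}_d(G)$; it is an $\mathcal{R}_d$-circuit if $G$ is not $\mathcal{R}_d$-independent but $G-f$ is $\mathcal{R}_d$-independent for all $f\in E$.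
   Formalization: It is additionally assumed that neither E_1 ⊆ E_2 nor E_2 ⊆ E_1 (neither summand is just the common K_t, up to isolated vertices), since otherwise the claim fails, e.g. d=1, G a 4-cycle, G_2=K_2; uniqueness of G_i' is as an edge set. *)

theory Defs
  imports Complex_Main "HOL-Library.Poly_Mapping"
begin

datatype 'v graph = Graph (verts: "'v set") (edges: "'v set set")

definition simple_graph :: "'v graph \<Rightarrow> bool" where
  "simple_graph G \<longleftrightarrow> finite (verts G) \<and> (\<forall>f\<in>edges G. f \<subseteq> verts G \<and> card f = 2)"

definition subgraph :: "'v graph \<Rightarrow> 'v graph \<Rightarrow> bool" where
  "subgraph H G \<longleftrightarrow> simple_graph H \<and> verts H \<subseteq> verts G \<and> edges H \<subseteq> edges G"

definition graph_union :: "'v graph \<Rightarrow> 'v graph \<Rightarrow> 'v graph" where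
  "graph_union G H = Graph (verts G \<union> verts H) (edges G \<union> edges H)"

definition graph_inter :: "'v graph \<Rightarrow> 'v graph \<Rightarrow> 'v graph" where
  "graph_inter G H = Graph (verts G \<inter> verts H) (edges G \<inter> edges H)"

definition delete_edge :: "'v graph \<Rightarrow> 'v set \<Rightarrow> 'v graph" where
  "delete_edge G f = Graph (verts G) (edges G - {f})"

definition complete_graph_on :: "nat \<Rightarrow> 'v graph \<Rightarrow> bool" where
  "complete_graph_on t G \<longleftrightarrow> finite (verts G) \<and> card (verts G) = t \<and>
     edges G = {f. f \<subseteq> verts G \<and> card f = 2}"

definition t_sum :: "nat \<Rightarrow> 'v set \<Rightarrow> 'v graph \<Rightarrow> 'v graph \<Rightarrow> 'v graph \<Rightarrow> bool" where
  "t_sum t e G1 G2 G \<longleftrightarrow>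
     G = delete_edge (graph_union G1 G2) e \<and>
     complete_graph_on t (graph_inter G1 G2) \<and>
     e \<in> edges G1 \<inter> edges G2"

text \<open>Polynomials over the rationals in indeterminates of type \<open>'i\<close> are finitely supported maps
  from monomials (finitely supported exponent vectors) to coefficients.\<close>

definition eval_rat_poly :: "('i \<Rightarrow> real) \<Rightarrow> (('i \<Rightarrow>\<^sub>0 nat) \<Rightarrow>\<^sub>0 rat) \<Rightarrow> real" where
  "eval_rat_poly x P =
     (\<Sum>m\<in>Poly_Mapping.keys P. of_rat (Poly_Mapping.lookup P m) *
        (\<Prod>i\<in>Poly_Mapping.keys m. x i ^ Poly_Mapping.lookup m i))"

definition alg_independent_over_rat :: "'i set \<Rightarrow> ('i \<Rightarrow> real) \<Rightarrow> bool" where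
  "alg_independent_over_rat I x \<longleftrightarrow>
     (\<forall>P :: ('i \<Rightarrow>\<^sub>0 nat) \<Rightarrow>\<^sub>0 rat.
        (\<forall>m\<in>Poly_Mapping.keys P. Poly_Mapping.keys m \<subseteq> I) \<and> eval_rat_poly x P = 0 \<longrightarrow> P = 0)"

text \<open>A realisation in dimension \<open>d\<close> is a map \<open>p\<close> with \<open>p v k\<close> the \<open>k\<close>-th coordinate of the point
  of \<open>v\<close>; only the values at vertices of the graph and at \<open>k < d\<close> are relevant.\<close>

definition generic :: "nat \<Rightarrow> 'v graph \<Rightarrow> ('v \<Rightarrow> nat \<Rightarrow> real) \<Rightarrow> bool" where
  "generic d G p \<longleftrightarrow> alg_independent_over_rat (verts G \<times> {..<d}) (\<lambda>(v, k). p v k)"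

text \<open>Rows of the matrix are indexed by the edges, columns by the pairs \<open>(v, k)\<close> with \<open>v\<close> a vertex
  and \<open>k < d\<close>. For an edge \<open>f\<close> containing \<open>v\<close>, \<open>the_elem (f - {v})\<close> is its other end.\<close>

definition rigidity_matrix :: "('v \<Rightarrow> nat \<Rightarrow> real) \<Rightarrow> 'v set \<Rightarrow> 'v \<times> nat \<Rightarrow> real" where
  "rigidity_matrix p f = (\<lambda>(v, k). if v \<in> f then p v k - p (the_elem (f - {v})) k else 0)"

definition rows_independent ::
    "nat \<Rightarrow> 'v graph \<Rightarrow> ('v \<Rightarrow> nat \<Rightarrow> real) \<Rightarrow> 'v set set \<Rightarrow> bool" where
  "rows_independent d G p F \<longleftrightarrow>
     (\<forall>c :: 'v set \<Rightarrow> real.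
        (\<forall>x \<in> verts G \<times> {..<d}. (\<Sum>f\<in>F. c f * rigidity_matrix p f x) = 0) \<longrightarrow>
        (\<forall>f\<in>F. c f = 0))"

definition rigidity_matroid_indep :: "nat \<Rightarrow> 'v graph \<Rightarrow> 'v set set \<Rightarrow> bool" where
  "rigidity_matroid_indep d G F \<longleftrightarrow>
     F \<subseteq> edges G \<and> (\<exists>p. generic d G p \<and> rows_independent d G p F)"

definition R_independent :: "nat \<Rightarrow> 'v graph \<Rightarrow> bool" where
  "R_independent d G \<longleftrightarrow> rigidity_matroid_indep d G (edges G)"

definition R_circuit :: "nat \<Rightarrow> 'v graph \<Rightarrow> bool" where
  "R_circuit d G \<longleftrightarrow>
     \<not> R_independent d G \<and> (\<forall>f\<in>edges G. R_independent d (delete_edge G f))"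

text \<open>Adding isolated vertices to a graph does not affect \<open>R_circuit\<close>, so a circuit inside a given
  graph can only be unique as an edge set.\<close>

definition unique_R_circuit_in :: "nat \<Rightarrow> 'v graph \<Rightarrow> 'v graph \<Rightarrow> bool" where
  "unique_R_circuit_in d G C \<longleftrightarrow>
     subgraph C G \<and> R_circuit d C \<and>
     (\<forall>H. subgraph H G \<and> R_circuit d H \<longrightarrow> edges H = edges C)"

end

theory Submission
  imports Defs
begin

text \<open>At a generic \<open>p\<close>, the circuit \<open>G\<close> carries a stress \<open>\<omega>\<close>, nowhere zero and unique up to
  scaling. The part of \<open>\<omega>\<close> on \<open>E\<^sub>2 - E\<^sub>1\<close> puts an equilibrium load on the common vertices of \<open>G\<^sub>1\<close>
  and \<open>G\<^sub>2\<close>. These are at most \<open>d + 1\<close> affinely independent points, so their complete graph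
  resolves the load, and \<open>\<omega> = \<sigma>\<^sub>1 + \<sigma>\<^sub>2\<close> with \<open>\<sigma>\<^sub>i\<close> a nonzero stress of \<open>G\<^sub>i\<close>. A stress of \<open>G\<^sub>i\<close>
  vanishing at \<open>e\<close> lives on a proper subset of \<open>E(G)\<close> and hence is zero, so \<open>\<sigma>\<^sub>i\<close> spans the
  stresses of \<open>G\<^sub>i\<close> and its support is the only circuit in \<open>G\<^sub>i\<close>.\<close>

section \<open>Polynomial functions over the rationals\<close>

text \<open>Working with functions that have some representing polynomial gives closure under ring
  operations without computing coefficients.\<close>

definition rat_poly_fun :: "'i set \<Rightarrow> (('i \<Rightarrow> real) \<Rightarrow> real) \<Rightarrow> bool" where
  "rat_poly_fun I f \<longleftrightarrow>
     (\<exists>P :: ('i \<Rightarrow>\<^sub>0 nat) \<Rightarrow>\<^sub>0 rat.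
        (\<forall>m\<in>Poly_Mapping.keys P. Poly_Mapping.keys m \<subseteq> I) \<and> (\<forall>x. f x = eval_rat_poly x P))"

text \<open>Cancellation can shrink the keys of a sum, so evaluations are compared termwise over one
  common finite set of monomials.\<close>

lemma eval_rat_poly_superset:
  assumes "finite S" "Poly_Mapping.keys P \<subseteq> S"
  shows "eval_rat_poly x P = (\<Sum>m\<in>S. of_rat (Poly_Mapping.lookup P m) *
        (\<Prod>i\<in>Poly_Mapping.keys m. x i ^ Poly_Mapping.lookup m i))"
  unfolding eval_rat_poly_def using assms
  by (intro sum.mono_neutral_left) (auto simp: in_keys_iff)

lemma eval_rat_poly_add: "eval_rat_poly x (P + Q) = eval_rat_poly x P + eval_rat_poly x Q"
proof -
  let ?S = "Poly_Mapping.keys P \<union> Poly_Mapping.keys Q"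
  have "eval_rat_poly x R = (\<Sum>m\<in>?S. of_rat (Poly_Mapping.lookup R m) *
        (\<Prod>i\<in>Poly_Mapping.keys m. x i ^ Poly_Mapping.lookup m i))"
    if "Poly_Mapping.keys R \<subseteq> ?S" for R
    using that by (intro eval_rat_poly_superset) auto
  then show ?thesis
    using Poly_Mapping.keys_add[of P Q]
    by (simp add: lookup_add of_rat_add distrib_right sum.distrib)
qed

lemma eval_rat_poly_single:
  "eval_rat_poly x (Poly_Mapping.single m c) =
     of_rat c * (\<Prod>i\<in>Poly_Mapping.keys m. x i ^ Poly_Mapping.lookup m i)"
  by (subst eval_rat_poly_superset[of "{m}"]) auto

lemma rat_poly_fun_monomial:
  assumes "Poly_Mapping.keys m \<subseteq> I"
  shows "rat_poly_fun I (\<lambda>x. of_rat c * (\<Prod>i\<in>Poly_Mapping.keys m. x i ^ Poly_Mapping.lookup m i))"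
  unfolding rat_poly_fun_def
  by (rule exI[of _ "Poly_Mapping.single m c"]) (use assms in \<open>auto simp: eval_rat_poly_single\<close>)

lemma rat_poly_fun_const: "rat_poly_fun I (\<lambda>x. of_rat c)"
  using rat_poly_fun_monomial[of 0 I c] by simp

lemma rat_poly_fun_var: "i \<in> I \<Longrightarrow> rat_poly_fun I (\<lambda>x. x i)"
  using rat_poly_fun_monomial[of "Poly_Mapping.single i 1" I 1] by simp

lemma rat_poly_fun_add:
  assumes "rat_poly_fun I f" "rat_poly_fun I g"
  shows "rat_poly_fun I (\<lambda>x. f x + g x)"
proof -
  obtain P Q where "\<forall>m\<in>Poly_Mapping.keys P. Poly_Mapping.keys m \<subseteq> I" "\<forall>x. f x = eval_rat_poly x P"
    "\<forall>m\<in>Poly_Mapping.keys Q. Poly_Mapping.keys m \<subseteq> I" "\<forall>x. g x = eval_rat_poly x Q"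
    using assms unfolding rat_poly_fun_def by blast
  moreover from this have "\<forall>m\<in>Poly_Mapping.keys (P + Q). Poly_Mapping.keys m \<subseteq> I"
    using Poly_Mapping.keys_add[of P Q] by blast
  ultimately show ?thesis
    unfolding rat_poly_fun_def by (intro exI[of _ "P + Q"]) (simp add: eval_rat_poly_add)
qed

lemma rat_poly_fun_sum:
  assumes "\<And>a. a \<in> A \<Longrightarrow> rat_poly_fun I (f a)"
  shows "rat_poly_fun I (\<lambda>x. \<Sum>a\<in>A. f a x)"
  using assms
proof (induction A rule: infinite_finite_induct)
  case (insert a A)
  then show ?case by (simp add: rat_poly_fun_add)
qed (use rat_poly_fun_const[of I 0] in simp_all)

lemma monomial_mult:
  fixes x :: "'i \<Rightarrow> real" and m n :: "'i \<Rightarrow>\<^sub>0 nat"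
  shows "(\<Prod>i\<in>Poly_Mapping.keys m. x i ^ Poly_Mapping.lookup m i) *
     (\<Prod>i\<in>Poly_Mapping.keys n. x i ^ Poly_Mapping.lookup n i) =
     (\<Prod>i\<in>Poly_Mapping.keys (m + n). x i ^ Poly_Mapping.lookup (m + n) i)"
proof -
  let ?S = "Poly_Mapping.keys m \<union> Poly_Mapping.keys n"
  have ext: "(\<Prod>i\<in>Poly_Mapping.keys k. x i ^ Poly_Mapping.lookup k i) =
        (\<Prod>i\<in>?S. x i ^ Poly_Mapping.lookup k i)"
    if "Poly_Mapping.keys k \<subseteq> ?S" for k
    using that by (intro prod.mono_neutral_left) (auto simp: in_keys_iff)
  show ?thesis
    unfolding ext[of m, OF Un_upper1] ext[of n, OF Un_upper2]
      ext[OF Poly_Mapping.keys_add[of m n]]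
    by (simp add: lookup_add power_add prod.distrib)
qed

lemma rat_poly_fun_mult:
  assumes "rat_poly_fun I f" "rat_poly_fun I g"
  shows "rat_poly_fun I (\<lambda>x. f x * g x)"
proof -
  obtain P Q where P: "\<forall>m\<in>Poly_Mapping.keys P. Poly_Mapping.keys m \<subseteq> I" "\<forall>x. f x = eval_rat_poly x P"
    and Q: "\<forall>m\<in>Poly_Mapping.keys Q. Poly_Mapping.keys m \<subseteq> I" "\<forall>x. g x = eval_rat_poly x Q"
    using assms unfolding rat_poly_fun_def by blast
  \<comment> \<open>Like monomials are not collected: closure under sums already turns this double
    sum into a polynomial function.\<close>
  have "f x * g x = (\<Sum>m\<in>Poly_Mapping.keys P. \<Sum>n\<in>Poly_Mapping.keys Q.
      of_rat (Poly_Mapping.lookup P m * Poly_Mapping.lookup Q n) *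
      (\<Prod>i\<in>Poly_Mapping.keys (m + n). x i ^ Poly_Mapping.lookup (m + n) i))" for x
    unfolding P(2)[rule_format] Q(2)[rule_format] eval_rat_poly_def sum_product
      monomial_mult[symmetric] of_rat_mult
    by (simp add: mult_ac)
  moreover have "rat_poly_fun I (\<lambda>x. \<Sum>m\<in>Poly_Mapping.keys P. \<Sum>n\<in>Poly_Mapping.keys Q.
      of_rat (Poly_Mapping.lookup P m * Poly_Mapping.lookup Q n) *
      (\<Prod>i\<in>Poly_Mapping.keys (m + n). x i ^ Poly_Mapping.lookup (m + n) i))"
  proof (intro rat_poly_fun_sum rat_poly_fun_monomial)
    fix m n assume "m \<in> Poly_Mapping.keys P" "n \<in> Poly_Mapping.keys Q"
    then show "Poly_Mapping.keys (m + n) \<subseteq> I"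
      using P(1) Q(1) Poly_Mapping.keys_add[of m n] by blast
  qed
  ultimately show ?thesis by simp
qed

lemma rat_poly_fun_diff:
  assumes "rat_poly_fun I f" "rat_poly_fun I g"
  shows "rat_poly_fun I (\<lambda>x. f x - g x)"
  using rat_poly_fun_add[OF assms(1) rat_poly_fun_mult[OF rat_poly_fun_const[of I "-1"] assms(2)]]
  by (simp add: of_rat_minus)

text \<open>The representing polynomial itself must be zero. Used in contrapositive form: nonzero at
  some \<open>q\<close> implies nonzero at the independent point \<open>p\<close>.\<close>

lemma rat_poly_fun_eq_0:
  assumes "alg_independent_over_rat I p" "rat_poly_fun I f" "f p = 0"
  shows "f q = 0"
proof -
  obtain P where P: "\<forall>m\<in>Poly_Mapping.keys P. Poly_Mapping.keys m \<subseteq> I" "\<forall>x. f x = eval_rat_poly x P"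
    using assms(2) unfolding rat_poly_fun_def by blast
  with assms(1,3) have "P = 0"
    unfolding alg_independent_over_rat_def by metis
  with P(2) show ?thesis by (simp add: eval_rat_poly_def)
qed

section \<open>Linear independence of the rows of a matrix\<close>

definition lin_indep_rows :: "'a set \<Rightarrow> 'b set \<Rightarrow> ('a \<Rightarrow> 'b \<Rightarrow> real) \<Rightarrow> bool" where
  "lin_indep_rows F X M \<longleftrightarrow>
     (\<forall>c. (\<forall>x\<in>X. (\<Sum>f\<in>F. c f * M f x) = 0) \<longrightarrow> (\<forall>f\<in>F. c f = 0))"

text \<open>Elimination without division, so that polynomial entries stay polynomial.\<close>

definition pivot :: "'a \<Rightarrow> 'b \<Rightarrow> ('a \<Rightarrow> 'b \<Rightarrow> real) \<Rightarrow> 'a \<Rightarrow> 'b \<Rightarrow> real" where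
  "pivot a b M = (\<lambda>f x. M a b * M f x - M f b * M a x)"

text \<open>Pivoting scales row \<open>f\<close> by the nonzero \<open>M a b\<close> and subtracts a
  multiple of row \<open>a\<close>, so relations can be carried both ways.\<close>

lemma lin_indep_rows_pivot:
  assumes "finite F" "a \<notin> F" "b \<in> X" "M a b \<noteq> 0"
  shows "lin_indep_rows (insert a F) X M \<longleftrightarrow> lin_indep_rows F X (pivot a b M)"
proof
  assume ind: "lin_indep_rows (insert a F) X M"
  show "lin_indep_rows F X (pivot a b M)"
    unfolding lin_indep_rows_def
  proof (intro allI impI)
    fix c assume c: "\<forall>x\<in>X. (\<Sum>f\<in>F. c f * pivot a b M f x) = 0"
    \<comment> \<open>The coefficient of \<open>a\<close> collects the multiples of row
      \<open>a\<close> subtracted by the pivoting.\<close>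
    define c' where "c' f = (if f = a then - (\<Sum>f\<in>F. c f * M f b) else c f * M a b)" for f
    have "(\<Sum>f\<in>insert a F. c' f * M f x) = (\<Sum>f\<in>F. c f * pivot a b M f x)" for x
    proof -
      have "(\<Sum>f\<in>F. c' f * M f x) = (\<Sum>f\<in>F. c f * M a b * M f x)"
        using assms(2) by (intro sum.cong) (auto simp: c'_def)
      moreover have "c' a * M a x = - (\<Sum>f\<in>F. c f * M f b * M a x)"
        by (simp add: c'_def sum_distrib_right)
      ultimately show ?thesis
        using assms(1,2)
        by (simp add: pivot_def right_diff_distrib sum_subtractf mult.assoc)
    qed
    with c have "\<forall>x\<in>X. (\<Sum>f\<in>insert a F. c' f * M f x) = 0" by simp
    then have "\<forall>f\<in>insert a F. c' f = 0"
      using ind[unfolded lin_indep_rows_def, THEN spec[of _ c']] by blast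
    then show "\<forall>f\<in>F. c f = 0"
      using assms(2,4) by (auto simp: c'_def split: if_splits)
  qed
next
  assume ind: "lin_indep_rows F X (pivot a b M)"
  show "lin_indep_rows (insert a F) X M"
    unfolding lin_indep_rows_def
  proof (intro allI impI)
    fix c assume "\<forall>x\<in>X. (\<Sum>f\<in>insert a F. c f * M f x) = 0"
    then have c: "c a * M a x + (\<Sum>f\<in>F. c f * M f x) = 0" if "x \<in> X" for x
      using that assms(1,2) by simp
    have "(\<Sum>f\<in>F. c f * pivot a b M f x) = 0" if "x \<in> X" for x
    proof -
      have "(\<Sum>f\<in>F. c f * pivot a b M f x) =
          M a b * (\<Sum>f\<in>F. c f * M f x) - M a x * (\<Sum>f\<in>F. c f * M f b)"
        by (simp add: pivot_def right_diff_distrib sum_subtractf sum_distrib_left mult_ac)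
      also have "\<dots> = M a b * (- c a * M a x) - M a x * (- c a * M a b)"
        using c[OF that] c[OF assms(3)] by (simp add: add_eq_0_iff)
      finally show ?thesis by simp
    qed
    with ind have F: "\<forall>f\<in>F. c f = 0"
      unfolding lin_indep_rows_def by blast
    with c[OF assms(3)] assms(4) show "\<forall>f\<in>insert a F. c f = 0" by simp
  qed
qed

lemma lin_indep_rows_nonzero_entry:
  assumes "lin_indep_rows F X M" "a \<in> F"
  obtains b where "b \<in> X" "M a b \<noteq> 0"
proof -
  have "\<exists>b\<in>X. M a b \<noteq> 0"
  proof (rule ccontr)
    assume neg: "\<not> ?thesis"
    let ?c = "\<lambda>f. if f = a then 1 else (0::real)"
    have "\<forall>x\<in>X. (\<Sum>f\<in>F. ?c f * M f x) = 0"
      using neg by (intro ballI sum.neutral) auto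
    then have "\<forall>f\<in>F. ?c f = 0"
      using assms(1)[unfolded lin_indep_rows_def, THEN spec[of _ ?c]] by blast
    with assms(2) show False by auto
  qed
  then show ?thesis using that by blast
qed

text \<open>Gaussian elimination is run at \<open>q\<close> and \<open>p\<close> in parallel, with
  no determinants. A pivot entry nonzero at \<open>q\<close> is a nonzero polynomial, hence nonzero
  at \<open>p\<close>, and the pivoted entries are again polynomials.\<close>

lemma lin_indep_rows_transfer:
  assumes "finite F" "alg_independent_over_rat I p"
    and "\<And>f x. f \<in> F \<Longrightarrow> x \<in> X \<Longrightarrow> rat_poly_fun I (\<lambda>y. M y f x)"
    and "lin_indep_rows F X (M q)"
  shows "lin_indep_rows F X (M p)"
  using assms(1,3,4)
proof (induction F arbitrary: M)
  case empty
  then show ?case by (simp add: lin_indep_rows_def)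
next
  case (insert a F)
  obtain b where b: "b \<in> X" "M q a b \<noteq> 0"
    using lin_indep_rows_nonzero_entry[OF insert.prems(2), of a] insert.hyps by auto
  then have "M p a b \<noteq> 0"
    using rat_poly_fun_eq_0[OF assms(2) insert.prems(1)] by blast
  moreover have "lin_indep_rows F X (pivot a b (M p))"
  proof (rule insert.IH[of "\<lambda>y. pivot a b (M y)"])
    show "lin_indep_rows F X (pivot a b (M q))"
      using lin_indep_rows_pivot[OF insert.hyps(1,2) b(1), of "M q"] b insert.prems(2) by blast
    show "rat_poly_fun I (\<lambda>y. pivot a b (M y) f x)" if "f \<in> F" "x \<in> X" for f x
      unfolding pivot_def using that b(1) insert.prems(1)
      by (intro rat_poly_fun_diff rat_poly_fun_mult) auto
  qed
  ultimately show ?case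
    using lin_indep_rows_pivot[OF insert.hyps(1,2) b(1), of "M p"] by blast
qed

text \<open>Elimination followed by back substitution. Its purpose is to produce a dual basis for
  independent points.\<close>

lemma lin_indep_rows_solvable:
  assumes "finite F" "finite X" "lin_indep_rows F X M"
  shows "\<exists>y. \<forall>f\<in>F. (\<Sum>x\<in>X. M f x * y x) = r f"
  using assms(1,3)
proof (induction F arbitrary: M r)
  case empty
  then show ?case by simp
next
  case (insert a F)
  obtain b where b: "b \<in> X" "M a b \<noteq> 0"
    using lin_indep_rows_nonzero_entry[OF insert.prems, of a] insert.hyps by auto
  have "lin_indep_rows F X (pivot a b M)"
    using lin_indep_rows_pivot[OF insert.hyps(1,2) b(1), of M] b insert.prems by blast
  from insert.IH[OF this, of "\<lambda>f. M a b * r f - M f b * r a"]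
  obtain y where y: "\<forall>f\<in>F. (\<Sum>x\<in>X. pivot a b M f x * y x) = M a b * r f - M f b * r a"
    by blast
  \<comment> \<open>Only coordinate \<open>b\<close> is corrected, so that row \<open>a\<close>
    holds. The pivoted rows are zero in column \<open>b\<close> and stay satisfied.\<close>
  define y' where "y' x = y x + (if x = b then (r a - (\<Sum>x\<in>X. M a x * y x)) / M a b else 0)" for x
  have y': "(\<Sum>x\<in>X. N x * y' x) =
      (\<Sum>x\<in>X. N x * y x) + N b * ((r a - (\<Sum>x\<in>X. M a x * y x)) / M a b)" for N
    using b(1) assms(2)
    by (simp add: y'_def distrib_left sum.distrib if_distrib[of "\<lambda>z. _ * z"] cong: if_cong)
  have a: "(\<Sum>x\<in>X. M a x * y' x) = r a"
    using b(2) by (simp add: y')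
  have "(\<Sum>x\<in>X. M f x * y' x) = r f" if "f \<in> F" for f
  proof -
    have "M a b * (\<Sum>x\<in>X. M f x * y' x) - M f b * (\<Sum>x\<in>X. M a x * y' x) =
        (\<Sum>x\<in>X. pivot a b M f x * y' x)"
      by (simp add: pivot_def sum_distrib_left sum_subtractf[symmetric] algebra_simps)
    also have "\<dots> = (\<Sum>x\<in>X. pivot a b M f x * y x)"
      unfolding y' by (simp add: pivot_def)
    also have "\<dots> = M a b * r f - M f b * r a"
      using y that by blast
    finally show ?thesis using a b(2) by simp
  qed
  with a show ?case by blast
qed

section \<open>Equilibrium loads on affinely independent points\<close>

text \<open>In homogeneous coordinates the force and torque balance become the single symmetry
  condition \<open>sym\<close>. Contracting it with the dual basis gives
  \<open>L v = (\<Sum>w\<in>X. a w v \<cdot> P w)\<close> with a symmetric matrix \<open>a\<close>, and the coordinate \<open>k0\<close> gives zero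
  column sums.\<close>

lemma equilibrium_load_resolution:
  fixes P L :: "'v \<Rightarrow> 'k \<Rightarrow> real"
  assumes fin: "finite X" "finite K" and ind: "lin_indep_rows X K P"
    and sym: "\<And>k l. k \<in> K \<Longrightarrow> l \<in> K \<Longrightarrow> (\<Sum>v\<in>X. L v k * P v l) = (\<Sum>v\<in>X. L v l * P v k)"
    and k0: "k0 \<in> K" "\<And>v. v \<in> X \<Longrightarrow> P v k0 = 1" "\<And>v. v \<in> X \<Longrightarrow> L v k0 = 0"
  shows "\<exists>s. (\<forall>u\<in>X. \<forall>v\<in>X. s u v = s v u) \<and>
     (\<forall>v\<in>X. \<forall>k\<in>K. L v k = (\<Sum>w\<in>X - {v}. s v w * (P v k - P w k)))"
proof -
  \<comment> \<open>The solution for \<open>u\<close> is the dual vector that pairs to 1 with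
    \<open>P u\<close> and to 0 with the other points.\<close>
  have "\<exists>y. \<forall>v\<in>X. (\<Sum>k\<in>K. P v k * y k) = (if v = u then 1 else 0)" for u
    by (rule lin_indep_rows_solvable[OF fin ind])
  then obtain dual where dual: "\<And>u v. v \<in> X \<Longrightarrow> (\<Sum>k\<in>K. P v k * dual u k) = (if v = u then 1 else 0)"
    by metis
  define a where "a w v = (\<Sum>l\<in>K. L w l * dual v l)" for w v
  have L: "L v k = (\<Sum>w\<in>X. a w v * P w k)" if "v \<in> X" "k \<in> K" for v k
  proof -
    have "L v k = (\<Sum>w\<in>X. L w k * (\<Sum>l\<in>K. P w l * dual v l))"
      using that fin by (simp add: dual if_distrib[of "\<lambda>z. _ * z"] cong: if_cong)
    also have "\<dots> = (\<Sum>l\<in>K. (\<Sum>w\<in>X. L w k * P w l) * dual v l)"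
      by (simp add: sum_distrib_left sum_distrib_right mult.assoc sum.swap[of _ X K])
    also have "\<dots> = (\<Sum>l\<in>K. (\<Sum>w\<in>X. L w l * P w k) * dual v l)"
      using sym that by (intro sum.cong) auto
    also have "\<dots> = (\<Sum>w\<in>X. a w v * P w k)"
      by (simp add: a_def sum_distrib_left sum_distrib_right mult_ac sum.swap[of _ X K])
    finally show ?thesis .
  qed
  have a_sym: "a u v = a v u" if "u \<in> X" "v \<in> X" for u v
  proof -
    have "a u v = (\<Sum>l\<in>K. (\<Sum>w\<in>X. a w u * P w l) * dual v l)"
      unfolding a_def[of u v] using that by (intro sum.cong) (simp_all add: L)
    also have "\<dots> = (\<Sum>w\<in>X. a w u * (\<Sum>l\<in>K. P w l * dual v l))"
      by (simp add: sum_distrib_left sum_distrib_right mult.assoc sum.swap[of _ X K])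
    also have "\<dots> = a v u"
      using that fin by (simp add: dual if_distrib[of "\<lambda>z. _ * z"] cong: if_cong)
    finally show ?thesis .
  qed
  have a_sum: "(\<Sum>w\<in>X. a w v) = 0" if "v \<in> X" for v
    using L[OF that k0(1)] k0(3)[OF that] k0(2) by simp
  \<comment> \<open>Subtracting \<open>P v k\<close> times the zero column sum produces differences
    of points, and the flipped difference explains the sign of \<open>- a v w\<close>.\<close>
  have "L v k = (\<Sum>w\<in>X - {v}. - a v w * (P v k - P w k))" if "v \<in> X" "k \<in> K" for v k
  proof -
    have "L v k = (\<Sum>w\<in>X. a w v * P w k) - (\<Sum>w\<in>X. a w v) * P v k"
      using L a_sum that by simp
    also have "\<dots> = (\<Sum>w\<in>X. - a v w * (P v k - P w k))"
      unfolding sum_distrib_right sum_subtractf[symmetric]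
      using that by (intro sum.cong) (simp_all add: a_sym algebra_simps)
    also have "\<dots> = (\<Sum>w\<in>X - {v}. - a v w * (P v k - P w k))"
      using fin by (intro sum.mono_neutral_right) auto
    finally show ?thesis .
  qed
  then show ?thesis
    using a_sym by (intro exI[of _ "\<lambda>u v. - a u v"]) auto
qed

section \<open>Stresses\<close>

text \<open>The support condition lets one function be a stress of several edge sets, and
  quantifying over all \<open>v\<close> avoids naming a vertex set.\<close>

definition stress :: "nat \<Rightarrow> ('v \<Rightarrow> nat \<Rightarrow> real) \<Rightarrow> 'v set set \<Rightarrow> ('v set \<Rightarrow> real) \<Rightarrow> bool" where
  "stress d p F c \<longleftrightarrow> (\<forall>f. c f \<noteq> 0 \<longrightarrow> f \<in> F) \<and>
     (\<forall>v. \<forall>k<d. (\<Sum>f\<in>F. c f * rigidity_matrix p f (v, k)) = 0)"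

lemma stress_add_scaled:
  assumes "stress d p F a" "stress d p F b"
  shows "stress d p F (\<lambda>f. a f + r * b f)"
proof -
  have "(\<Sum>f\<in>F. (a f + r * b f) * rigidity_matrix p f (v, k)) =
      (\<Sum>f\<in>F. a f * rigidity_matrix p f (v, k)) + r * (\<Sum>f\<in>F. b f * rigidity_matrix p f (v, k))"
    for v k
    by (simp add: distrib_right sum.distrib sum_distrib_left mult.assoc)
  moreover have "f \<in> F" if "a f + r * b f \<noteq> 0" for f
    using assms that unfolding stress_def by (cases "a f = 0") auto
  ultimately show ?thesis
    using assms by (simp add: stress_def)
qed

lemma stress_cong_support:
  assumes "finite F" "F' \<subseteq> F" "\<And>f. c f \<noteq> 0 \<Longrightarrow> f \<in> F'"
  shows "stress d p F c \<longleftrightarrow> stress d p F' c"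
proof -
  have "(\<Sum>f\<in>F. c f * rigidity_matrix p f (v, k)) = (\<Sum>f\<in>F'. c f * rigidity_matrix p f (v, k))" for v k
    using assms by (intro sum.mono_neutral_right) auto
  then show ?thesis
    using assms by (auto simp: stress_def)
qed

lemma stress_mono: "finite F \<Longrightarrow> F' \<subseteq> F \<Longrightarrow> stress d p F' c \<Longrightarrow> stress d p F c"
  using stress_cong_support[of F F' c] by (auto simp: stress_def)

lemma stress_remove_zero:
  assumes "finite F" "stress d p F c" "c f = 0"
  shows "stress d p (F - {f}) c"
proof -
  have "g \<in> F - {f}" if "c g \<noteq> 0" for g
    using assms that by (auto simp: stress_def)
  then show ?thesis
    using stress_cong_support[OF assms(1), of "F - {f}" c] assms(2) by blast
qed

section \<open>Rows of single edges and loads of complete graphs\<close>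

lemma rigidity_matrix_pair:
  assumes "u \<noteq> w"
  shows "rigidity_matrix p {u, w} (v, k) =
    (if v = u then p u k - p w k else if v = w then p w k - p u k else 0)"
proof -
  have "{u, w} - {u} = {w}" "{u, w} - {w} = {u}"
    using assms by auto
  then show ?thesis
    by (auto simp: rigidity_matrix_def)
qed

text \<open>For \<open>f = {u, w}\<close> both sides equal
  \<open>(p u k - p w k) * (p u l - p w l)\<close>. This is the torque balance of one edge.\<close>

lemma rigidity_matrix_moment:
  assumes "finite V" "f \<subseteq> V" "card f = 2"
  shows "(\<Sum>v\<in>V. rigidity_matrix p f (v, k) * p v l) = (\<Sum>v\<in>V. rigidity_matrix p f (v, l) * p v k)"
proof -
  obtain u w where f: "f = {u, w}" "u \<noteq> w"
    using assms(3) by (auto simp: card_2_iff)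
  have supp: "(\<Sum>v\<in>V. rigidity_matrix p f (v, k) * p v l) = (\<Sum>v\<in>f. rigidity_matrix p f (v, k) * p v l)" for k l
    using assms by (intro sum.mono_neutral_right) (auto simp: rigidity_matrix_def)
  show ?thesis
    unfolding supp using f by (simp add: rigidity_matrix_pair algebra_simps)
qed

text \<open>Edges missing \<open>v\<close> contribute nothing and the others correspond to their
  second end. The right side has the shape delivered by
  \<open>equilibrium_load_resolution\<close>.\<close>

lemma rigidity_matrix_complete_graph_sum:
  assumes "finite X" "v \<in> X"
  shows "(\<Sum>f\<in>{f. f \<subseteq> X \<and> card f = 2}. c f * rigidity_matrix p f (v, k)) =
    (\<Sum>w\<in>X - {v}. c {v, w} * (p v k - p w k))"
proof -
  have "(\<Sum>f\<in>{f. f \<subseteq> X \<and> card f = 2}. c f * rigidity_matrix p f (v, k)) =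
      (\<Sum>f\<in>(\<lambda>w. {v, w}) ` (X - {v}). c f * rigidity_matrix p f (v, k))"
  proof (rule sum.mono_neutral_right)
    show "\<forall>f\<in>{f. f \<subseteq> X \<and> card f = 2} - (\<lambda>w. {v, w}) ` (X - {v}).
        c f * rigidity_matrix p f (v, k) = 0"
      using assms(2) by (auto simp: rigidity_matrix_def card_2_iff image_iff insert_commute)
  qed (use assms in auto)
  also have "\<dots> = (\<Sum>w\<in>X - {v}. c {v, w} * rigidity_matrix p {v, w} (v, k))"
    by (subst sum.reindex) (auto simp: inj_on_def doubleton_eq_iff)
  also have "\<dots> = (\<Sum>w\<in>X - {v}. c {v, w} * (p v k - p w k))"
    by (intro sum.cong) (auto simp: rigidity_matrix_pair)
  finally show ?thesis .
qed

text \<open>The constant coordinate \<open>d\<close> turns affine independence into linear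
  independence over the columns \<open>{..d}\<close>.\<close>

definition homogeneous :: "nat \<Rightarrow> ('v \<Rightarrow> nat \<Rightarrow> real) \<Rightarrow> 'v \<Rightarrow> nat \<Rightarrow> real" where
  "homogeneous d p v k = (if k < d then p v k else 1)"

lemma rigidity_matrix_homogeneous:
  "rigidity_matrix (homogeneous d p) f (v, k) = (if k < d then rigidity_matrix p f (v, k) else 0)"
  by (simp add: rigidity_matrix_def homogeneous_def)

section \<open>Splitting a stress along a common complete graph\<close>

lemma stress_split:
  assumes "finite V1" "\<And>f. f \<in> E1 \<Longrightarrow> f \<subseteq> V1 \<and> card f = 2"
    and "finite V2" "\<And>f. f \<in> E2 \<Longrightarrow> f \<subseteq> V2 \<and> card f = 2"
    and K: "E1 \<inter> E2 = {f. f \<subseteq> V1 \<inter> V2 \<and> card f = 2}"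
    and ind: "lin_indep_rows (V1 \<inter> V2) {..d} (homogeneous d p)"
    and \<omega>: "stress d p (E1 \<union> E2) \<omega>"
  shows "\<exists>\<sigma>1 \<sigma>2. stress d p E1 \<sigma>1 \<and> stress d p E2 \<sigma>2 \<and> (\<forall>f. \<omega> f = \<sigma>1 f + \<sigma>2 f)"
proof -
  let ?X = "V1 \<inter> V2" and ?P = "homogeneous d p"
  have fin: "finite E1" "finite E2" "finite ?X"
    using assms(1-4) finite_subset[of E1 "Pow V1"] finite_subset[of E2 "Pow V2"] by auto
  \<comment> \<open>Shared edges stay with the first graph for now; \<open>\<tau>\<close>
    redistributes them below.\<close>
  define \<omega>2 where "\<omega>2 f = (if f \<in> E2 - E1 then \<omega> f else 0)" for f
  define L where "L v k = (\<Sum>f\<in>E2. \<omega>2 f * rigidity_matrix ?P f (v, k))" for v k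
  \<comment> \<open>At a vertex of \<open>V2 - V1\<close> no edge of \<open>E1\<close> contributes,
    so the load is the full equilibrium sum of \<open>\<omega>\<close>. Otherwise all entries
    involved are zero.\<close>
  have L0: "L v k = 0" if "v \<notin> ?X" for v k
  proof (cases "v \<in> V2 \<and> k < d")
    case True
    with that have "v \<notin> V1" by blast
    then have "rigidity_matrix p f (v, k) = 0" if "f \<in> E1" for f
      using assms(2)[OF that] by (auto simp: rigidity_matrix_def)
    then have "L v k = (\<Sum>f\<in>E1 \<union> E2. \<omega> f * rigidity_matrix p f (v, k))"
      unfolding L_def using True fin
      by (intro sum.mono_neutral_cong_left) (auto simp: \<omega>2_def rigidity_matrix_homogeneous)
    with \<omega> True show ?thesis by (simp add: stress_def)
  next
    case False
    then have "rigidity_matrix ?P f (v, k) = 0" if "f \<in> E2" for f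
      using assms(4)[OF that] by (auto simp: rigidity_matrix_def homogeneous_def)
    then show ?thesis by (simp add: L_def)
  qed
  have sym: "(\<Sum>v\<in>?X. L v k * ?P v l) = (\<Sum>v\<in>?X. L v l * ?P v k)" for k l
  proof -
    \<comment> \<open>The load vanishes off the common vertices, so the sum extends to
      \<open>V2\<close> and splits into the symmetric moments of single edges.\<close>
    have moment: "(\<Sum>v\<in>?X. L v k * ?P v l) =
        (\<Sum>f\<in>E2. \<omega>2 f * (\<Sum>v\<in>V2. rigidity_matrix ?P f (v, k) * ?P v l))" for k l
    proof -
      have "(\<Sum>v\<in>?X. L v k * ?P v l) = (\<Sum>v\<in>V2. L v k * ?P v l)"
        using assms(3) L0 by (intro sum.mono_neutral_left) auto
      then show ?thesis
        by (simp add: L_def sum_distrib_left sum_distrib_right mult.assoc sum.swap[of _ V2])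
    qed
    show ?thesis
      unfolding moment using assms(3,4) by (intro sum.cong) (auto simp: rigidity_matrix_moment)
  qed
  have "\<exists>s. (\<forall>u\<in>?X. \<forall>v\<in>?X. s u v = s v u) \<and>
     (\<forall>v\<in>?X. \<forall>k\<in>{..d}. L v k = (\<Sum>w\<in>?X - {v}. s v w * (?P v k - ?P w k)))"
    by (rule equilibrium_load_resolution[OF fin(3) finite_atMost ind sym, where ?k0.0 = d])
      (auto simp: homogeneous_def L_def rigidity_matrix_homogeneous)
  then obtain s where s_sym: "\<And>u v. u \<in> ?X \<Longrightarrow> v \<in> ?X \<Longrightarrow> s u v = s v u"
    and s: "\<And>v k. v \<in> ?X \<Longrightarrow> k \<le> d \<Longrightarrow> L v k = (\<Sum>w\<in>?X - {v}. s v w * (?P v k - ?P w k))"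
    by (metis atMost_iff)
  \<comment> \<open>Summing over both orientations and halving reads the symmetric \<open>s\<close>
    on an unordered edge without choosing an order of its ends.\<close>
  define \<tau> where "\<tau> f = (if f \<in> E1 \<inter> E2 then (\<Sum>u\<in>f. \<Sum>w\<in>f - {u}. s u w) / 2 else 0)" for f
  have \<tau>: "\<tau> {u, w} = s u w" if "u \<in> ?X" "w \<in> ?X" "u \<noteq> w" for u w
  proof -
    have "{u, w} - {u} = {w}" "{u, w} - {w} = {u}"
      using that by auto
    then show ?thesis
      using that s_sym[of u w] unfolding \<tau>_def K by simp
  qed
  have L_\<tau>: "L v k = (\<Sum>f\<in>E2. \<tau> f * rigidity_matrix ?P f (v, k))" if "k \<le> d" for v k
  proof -
    have "(\<Sum>f\<in>E2. \<tau> f * rigidity_matrix ?P f (v, k)) =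
        (\<Sum>f\<in>E1 \<inter> E2. \<tau> f * rigidity_matrix ?P f (v, k))"
      using fin by (intro sum.mono_neutral_right) (auto simp: \<tau>_def)
    also have "\<dots> = L v k"
    proof (cases "v \<in> ?X")
      case True
      show ?thesis
        unfolding K rigidity_matrix_complete_graph_sum[OF fin(3) True] s[OF True that]
        using True by (intro sum.cong) (auto simp: \<tau>)
    next
      case False
      then have "rigidity_matrix ?P f (v, k) = 0" if "f \<in> E1 \<inter> E2" for f
        using that unfolding K by (auto simp: rigidity_matrix_def)
      with False show ?thesis by (simp add: L0)
    qed
    finally show ?thesis by simp
  qed
  \<comment> \<open>\<open>\<tau>\<close> and \<open>\<omega>2\<close> exert the same load, so their
    difference is in equilibrium.\<close>
  define \<sigma>2 where "\<sigma>2 f = \<omega>2 f - \<tau> f" for f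
  have "(\<Sum>f\<in>E2. \<sigma>2 f * rigidity_matrix p f (v, k)) = 0" if "k < d" for v k
    using L_\<tau>[of k v] that
    by (simp add: \<sigma>2_def L_def rigidity_matrix_homogeneous left_diff_distrib sum_subtractf)
  then have \<sigma>2: "stress d p E2 \<sigma>2"
    by (auto simp: stress_def \<sigma>2_def \<omega>2_def \<tau>_def split: if_splits)
  define \<sigma>1 where "\<sigma>1 f = \<omega> f + (- 1) * \<sigma>2 f" for f
  have "stress d p (E1 \<union> E2) \<sigma>1"
    unfolding \<sigma>1_def using \<omega> fin
    by (intro stress_add_scaled stress_mono[OF _ _ \<sigma>2]) auto
  \<comment> \<open>On \<open>E2 - E1\<close> the function \<open>\<tau>\<close> vanishes and
    \<open>\<omega>2\<close> equals \<open>\<omega>\<close>, so nothing remains there.\<close>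
  moreover have "f \<in> E1" if "\<sigma>1 f \<noteq> 0" for f
    using that \<omega> unfolding stress_def \<sigma>1_def \<sigma>2_def \<omega>2_def \<tau>_def by (auto split: if_splits)
  ultimately have "stress d p E1 \<sigma>1"
    using stress_cong_support[of "E1 \<union> E2" E1 \<sigma>1] fin by blast
  with \<sigma>2 show ?thesis
    by (intro exI[of _ \<sigma>1] exI[of _ \<sigma>2]) (auto simp: \<sigma>1_def)
qed

section \<open>Independence at a fixed generic realisation\<close>

lemma simple_graph_finite_edges: "simple_graph G \<Longrightarrow> finite (edges G)"
  unfolding simple_graph_def by (rule finite_subset[of _ "Pow (verts G)"]) auto

lemma alg_independent_over_rat_mono:
  "alg_independent_over_rat J x \<Longrightarrow> I \<subseteq> J \<Longrightarrow> alg_independent_over_rat I x"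
  unfolding alg_independent_over_rat_def by (meson subset_trans)

lemma rows_independent_iff_stress:
  assumes "simple_graph H"
  shows "rows_independent d H p (edges H) \<longleftrightarrow> (\<forall>c. stress d p (edges H) c \<longrightarrow> (\<forall>f. c f = 0))"
proof
  assume ind: "rows_independent d H p (edges H)"
  show "\<forall>c. stress d p (edges H) c \<longrightarrow> (\<forall>f. c f = 0)"
  proof (intro allI impI)
    fix c f assume c: "stress d p (edges H) c"
    then have "\<forall>x\<in>verts H \<times> {..<d}. (\<Sum>f\<in>edges H. c f * rigidity_matrix p f x) = 0"
      by (auto simp: stress_def)
    then have "\<forall>f\<in>edges H. c f = 0"
      using ind[unfolded rows_independent_def, THEN spec[of _ c]] by blast
    with c show "c f = 0"
      unfolding stress_def by blast
  qed
next
  assume *: "\<forall>c. stress d p (edges H) c \<longrightarrow> (\<forall>f. c f = 0)"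
  show "rows_independent d H p (edges H)"
    unfolding rows_independent_def
  proof (intro allI impI)
    fix c assume c: "\<forall>x\<in>verts H \<times> {..<d}. (\<Sum>f\<in>edges H. c f * rigidity_matrix p f x) = 0"
    \<comment> \<open>Extension by zero meets the support condition of
      \<open>stress\<close>.\<close>
    let ?c = "\<lambda>f. if f \<in> edges H then c f else 0"
    have "(\<Sum>f\<in>edges H. c f * rigidity_matrix p f (v, k)) = 0" if "k < d" for v k
    proof (cases "v \<in> verts H")
      case False
      then have "rigidity_matrix p f (v, k) = 0" if "f \<in> edges H" for f
        using assms that by (auto simp: simple_graph_def rigidity_matrix_def)
      then show ?thesis by simp
    qed (use c that in auto)
    then have "stress d p (edges H) ?c"
      by (simp add: stress_def)
    then have "\<forall>f. ?c f = 0"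
      using * by blast
    then show "\<forall>f\<in>edges H. c f = 0"
      by (auto split: if_splits)
  qed
qed

text \<open>Row independence at any witness \<open>q\<close> transfers to \<open>p\<close>, since
  the matrix entries are polynomials in the coordinates. One fixed generic \<open>p\<close> of
  \<open>G\<close> thus decides independence for all its subgraphs.\<close>

lemma R_independent_iff_stress:
  assumes "simple_graph H" "verts H \<subseteq> verts G" "generic d G p"
  shows "R_independent d H \<longleftrightarrow> (\<forall>c. stress d p (edges H) c \<longrightarrow> (\<forall>f. c f = 0))"
proof -
  have gen: "generic d H p"
    using assms(2,3) unfolding generic_def
    by (rule_tac alg_independent_over_rat_mono) auto
  have "rows_independent d H p (edges H)" if "rows_independent d H q (edges H)" for q
  proof -
    define M where "M y = rigidity_matrix (\<lambda>v k. y (v, k))" for y :: "'a \<times> nat \<Rightarrow> real"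
    have "lin_indep_rows (edges H) (verts H \<times> {..<d}) (M (\<lambda>(v, k). p v k))"
    proof (rule lin_indep_rows_transfer[where M = M and q = "\<lambda>(v, k). q v k"
          and I = "verts H \<times> {..<d}"])
      show "finite (edges H)"
        by (rule simple_graph_finite_edges) fact
      show "alg_independent_over_rat (verts H \<times> {..<d}) (\<lambda>(v, k). p v k)"
        using gen by (simp add: generic_def)
      show "lin_indep_rows (edges H) (verts H \<times> {..<d}) (M (\<lambda>(v, k). q v k))"
        using that by (simp add: lin_indep_rows_def rows_independent_def M_def)
      fix f x assume f: "f \<in> edges H" and x: "x \<in> verts H \<times> {..<d}"
      obtain u w where uw: "f = {u, w}" "u \<noteq> w" "u \<in> verts H" "w \<in> verts H"
        using assms(1) f unfolding simple_graph_def by (metis card_2_iff insert_subset)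
      obtain v k where [simp]: "x = (v, k)" by (cases x)
      have "rat_poly_fun (verts H \<times> {..<d}) (\<lambda>y. y (u, k) - y (w, k))"
        "rat_poly_fun (verts H \<times> {..<d}) (\<lambda>y. y (w, k) - y (u, k))"
        using x uw by (auto intro!: rat_poly_fun_diff rat_poly_fun_var)
      then show "rat_poly_fun (verts H \<times> {..<d}) (\<lambda>y. M y f x)"
        using rat_poly_fun_const[of "verts H \<times> {..<d}" 0] uw(2)
        by (cases "v = u"; cases "v = w") (simp_all add: M_def uw(1) rigidity_matrix_pair)
    qed
    then show ?thesis
      by (simp add: lin_indep_rows_def rows_independent_def M_def)
  qed
  then have "R_independent d H \<longleftrightarrow> rows_independent d H p (edges H)"
    unfolding R_independent_def rigidity_matroid_indep_def using gen by auto
  then show ?thesis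
    using rows_independent_iff_stress[OF assms(1)] by simp
qed

text \<open>By transfer it suffices to exhibit one affinely independent placement, here at vertices
  of the standard simplex.\<close>

lemma generic_affinely_independent:
  assumes "generic d G p" "X \<subseteq> verts G" "finite X" "card X \<le> d + 1"
  shows "lin_indep_rows X {..d} (homogeneous d p)"
proof -
  obtain g where g: "inj_on g X" "g ` X \<subseteq> {..d}"
    using card_le_inj[of X "{..d}"] assms(3,4) by auto
  \<comment> \<open>A vertex with \<open>g v < d\<close> goes to a unit vector and one with
    \<open>g v = d\<close> to the origin, as only coordinates below \<open>d\<close> are
    read.\<close>
  define q where "q v k = (if g v = k then 1 else 0 :: real)" for v k
  define M where "M y = homogeneous d (\<lambda>v k. y (v, k))" for y :: "'a \<times> nat \<Rightarrow> real"
  have "lin_indep_rows X {..d} (M (\<lambda>(v, k). p v k))"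
  proof (rule lin_indep_rows_transfer[where M = M and q = "\<lambda>(v, k). q v k"
        and I = "verts G \<times> {..<d}"])
    show "finite X" by fact
    show "alg_independent_over_rat (verts G \<times> {..<d}) (\<lambda>(v, k). p v k)"
      using assms(1) by (simp add: generic_def)
    show "rat_poly_fun (verts G \<times> {..<d}) (\<lambda>y. M y v k)" if "v \<in> X" for v k
      using that assms(2) rat_poly_fun_const[of "verts G \<times> {..<d}" 1]
      by (cases "k < d") (auto simp: M_def homogeneous_def intro: rat_poly_fun_var)
    show "lin_indep_rows X {..d} (M (\<lambda>(v, k). q v k))"
      unfolding lin_indep_rows_def
    proof (intro allI impI)
      fix c assume c: "\<forall>k\<in>{..d}. (\<Sum>v\<in>X. c v * M (\<lambda>(v, k). q v k) v k) = 0"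
      have lt: "c v = 0" if "v \<in> X" "g v < d" for v
      proof -
        have "0 = (\<Sum>u\<in>X. c u * q u (g v))"
          using bspec[OF c, of "g v"] that by (simp add: M_def homogeneous_def)
        also have "\<dots> = (\<Sum>u\<in>X. if u = v then c v else 0)"
          using g(1) that(1) by (intro sum.cong) (auto simp: q_def inj_on_eq_iff)
        finally show ?thesis using assms(3) that by simp
      qed
      show "\<forall>v\<in>X. c v = 0"
      proof
        fix v assume v: "v \<in> X"
        show "c v = 0"
        proof (cases "g v < d")
          case False
          \<comment> \<open>For the vertex at the origin, all other coefficients vanish and the
            constant coordinate \<open>d\<close> then kills its own.\<close>
          have "c u = 0" if "u \<in> X - {v}" for u
          proof (rule lt)
            have "g u \<noteq> g v" "g u \<le> d" "g v \<le> d"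
              using that v g by (auto simp: inj_on_eq_iff)
            with False show "g u < d" by simp
          qed (use that in auto)
          then have "(\<Sum>u\<in>X. c u) = c v"
            using v assms(3) by (simp add: sum.remove)
          moreover have "(\<Sum>u\<in>X. c u) = 0"
            using bspec[OF c, of d] by (simp add: M_def homogeneous_def)
          ultimately show ?thesis by simp
        qed (use lt v in auto)
      qed
    qed
  qed
  then show ?thesis
    by (simp add: M_def)
qed

text \<open>Evaluation at \<open>e\<close> is injective on stresses, so every stress is a multiple
  of \<open>\<sigma>\<close>. Dependent subgraphs are therefore exactly those containing its
  support.\<close>

lemma unique_R_circuit_in_support:
  assumes "simple_graph G1" "verts G1 \<subseteq> verts G" "generic d G p"
    and \<sigma>: "stress d p (edges G1) \<sigma>" "\<sigma> e \<noteq> 0"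
    and e: "\<And>c f. stress d p (edges G1) c \<Longrightarrow> c e = 0 \<Longrightarrow> c f = 0"
  shows "unique_R_circuit_in d G1 (Graph (verts G1) {f. \<sigma> f \<noteq> 0})"
proof -
  let ?C = "Graph (verts G1) {f. \<sigma> f \<noteq> 0}"
  have fin: "finite (edges G1)"
    by (rule simple_graph_finite_edges) fact
  have sub: "{f. \<sigma> f \<noteq> 0} \<subseteq> edges G1"
    using \<sigma>(1) by (auto simp: stress_def)
  have mult: "\<exists>r. \<forall>f. c f = r * \<sigma> f" if "F \<subseteq> edges G1" "stress d p F c" for F c
  proof -
    define r where "r = c e / \<sigma> e"
    have "stress d p (edges G1) (\<lambda>f. c f + (- r) * \<sigma> f)"
      by (rule stress_add_scaled[OF stress_mono[OF fin that] \<sigma>(1)])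
    then have "c f + (- r) * \<sigma> f = 0" for f
      by (rule e) (simp add: r_def \<sigma>(2))
    then have "\<forall>f. c f = r * \<sigma> f" by simp
    then show ?thesis by (rule exI)
  qed
  have ind: "R_independent d H \<longleftrightarrow> (\<forall>c. stress d p (edges H) c \<longrightarrow> (\<forall>f. c f = 0))"
    if "subgraph H G1" for H
    using that assms(2,3) by (intro R_independent_iff_stress[of _ G]) (auto simp: subgraph_def)
  have subgraph_C: "subgraph ?C G1"
    using assms(1) sub by (auto simp: subgraph_def simple_graph_def)
  have del: "subgraph (delete_edge H f) G1" if "subgraph H G1" for H f
    using that by (auto simp: subgraph_def simple_graph_def delete_edge_def)
  have dep: "\<not> R_independent d H" if "subgraph H G1" "{f. \<sigma> f \<noteq> 0} \<subseteq> edges H" for H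
  proof -
    have "edges H \<subseteq> edges G1"
      using that by (simp add: subgraph_def)
    then have "stress d p (edges H) \<sigma>"
      using stress_cong_support[OF fin, of "edges H" \<sigma>] that \<sigma> by blast
    with \<sigma>(2) ind[OF that(1)] show ?thesis by blast
  qed
  have "R_circuit d ?C"
    unfolding R_circuit_def
  proof (intro conjI ballI)
    show "\<not> R_independent d ?C"
      by (rule dep[OF subgraph_C]) simp
    fix f assume "f \<in> edges ?C"
    then have f: "\<sigma> f \<noteq> 0" by simp
    \<comment> \<open>A stress here is a multiple of \<open>\<sigma>\<close> vanishing at
      \<open>f\<close>, where \<open>\<sigma>\<close> does not vanish.\<close>
    show "R_independent d (delete_edge ?C f)"
      unfolding ind[OF del[OF subgraph_C]]
    proof (intro allI impI)
      fix c g assume c: "stress d p (edges (delete_edge ?C f)) c"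
      then obtain r where r: "\<And>f. c f = r * \<sigma> f"
        using mult[of "edges (delete_edge ?C f)" c] sub by (auto simp: delete_edge_def)
      have "c f = 0"
        using c by (auto simp: stress_def delete_edge_def)
      with r f show "c g = 0" by simp
    qed
  qed
  moreover have "edges H = edges ?C" if H: "subgraph H G1" "R_circuit d H" for H
  proof -
    obtain c f where c: "stress d p (edges H) c" "c f \<noteq> 0"
      using H ind[OF H(1)] unfolding R_circuit_def by blast
    then obtain r where r: "\<And>f. c f = r * \<sigma> f"
      using mult[of "edges H" c] H(1) by (auto simp: subgraph_def)
    with c(2) have "r \<noteq> 0" by auto
    with r c(1) have "{f. \<sigma> f \<noteq> 0} \<subseteq> edges H"
      by (auto simp: stress_def)
    \<comment> \<open>Deleting an edge off the support would leave \<open>H\<close> dependent,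
      against minimality.\<close>
    moreover have "\<sigma> f \<noteq> 0" if "f \<in> edges H" for f
    proof
      assume "\<sigma> f = 0"
      with \<open>{f. \<sigma> f \<noteq> 0} \<subseteq> edges H\<close> have "{f. \<sigma> f \<noteq> 0} \<subseteq> edges (delete_edge H f)"
        by (auto simp: delete_edge_def)
      from dep[OF del[OF H(1)] this] H(2) that show False
        by (auto simp: R_circuit_def)
    qed
    ultimately show ?thesis by auto
  qed
  ultimately show ?thesis
    using subgraph_C by (auto simp: unique_R_circuit_in_def)
qed

section \<open>The circuits in the two summands\<close>

theorem lemma1:
  fixes d t :: nat and G G1 G2 :: "'v graph" and e :: "'v set"
  assumes "d \<ge> 1"
    and "simple_graph G" and "simple_graph G1" and "simple_graph G2"
    and "2 \<le> t" and "t \<le> d + 1"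
    and "t_sum t e G1 G2 G"
    and "\<not> edges G1 \<subseteq> edges G2" and "\<not> edges G2 \<subseteq> edges G1"
    and "R_circuit d G"
  shows "\<exists>G1' G2'.
           unique_R_circuit_in d G1 G1' \<and> e \<in> edges G1' \<and>
           unique_R_circuit_in d G2 G2' \<and> e \<in> edges G2' \<and>
           edges G = (edges G1' \<union> edges G2') - {e}"
proof -
  have EG: "edges G = (edges G1 \<union> edges G2) - {e}" and VG: "verts G = verts G1 \<union> verts G2"
    and e: "e \<in> edges G1" "e \<in> edges G2"
    and X: "finite (verts G1 \<inter> verts G2)" "card (verts G1 \<inter> verts G2) = t"
    and K: "edges G1 \<inter> edges G2 = {f. f \<subseteq> verts G1 \<inter> verts G2 \<and> card f = 2}"
    using assms(7)
    by (auto simp: t_sum_def delete_edge_def graph_union_def graph_inter_def complete_graph_on_def)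
  have fin: "finite (edges G)" "finite (edges G1)" "finite (edges G2)"
    using assms(2-4) by (simp_all add: simple_graph_finite_edges)
  obtain f1 f2 where f1: "f1 \<in> edges G1" "f1 \<notin> edges G2" and f2: "f2 \<in> edges G2" "f2 \<notin> edges G1"
    using assms(8,9) by blast
  then have f: "f1 \<in> edges G" "f2 \<in> edges G"
    using EG e by auto
  \<comment> \<open>This supplies a generic realisation: independence asserts one, and deleting an
    edge keeps the vertex set.\<close>
  then have "R_independent d (delete_edge G f1)"
    using assms(10) by (simp add: R_circuit_def)
  then obtain p where gen: "generic d G p"
    by (auto simp: R_independent_def rigidity_matroid_indep_def generic_def delete_edge_def)
  have "\<not> (\<forall>c. stress d p (edges G) c \<longrightarrow> (\<forall>f. c f = 0))"
    using R_independent_iff_stress[OF assms(2) order_refl gen] assms(10) by (simp add: R_circuit_def)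
  then obtain \<omega> f0 where \<omega>: "stress d p (edges G) \<omega>" "\<omega> f0 \<noteq> 0"
    by blast
  have proper: "c g = 0" if "stress d p (edges G) c" "f \<in> edges G" "c f = 0" for c f g
  proof -
    have "simple_graph (delete_edge G f)"
      using assms(2) by (simp add: simple_graph_def delete_edge_def)
    from R_independent_iff_stress[OF this _ gen] assms(10) that(2)
    have "\<forall>c. stress d p (edges G - {f}) c \<longrightarrow> (\<forall>f. c f = 0)"
      by (simp add: R_circuit_def delete_edge_def)
    moreover have "stress d p (edges G - {f}) c"
      by (rule stress_remove_zero[OF fin(1) that(1,3)])
    ultimately show ?thesis by blast
  qed
  have nz: "\<omega> f \<noteq> 0" if "f \<in> edges G" for f
    using proper[OF \<omega>(1) that] \<omega>(2) by blast
  have "stress d p (edges G1 \<union> edges G2) \<omega>"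
    using fin EG by (intro stress_mono[OF _ _ \<omega>(1)]) auto
  moreover have "lin_indep_rows (verts G1 \<inter> verts G2) {..d} (homogeneous d p)"
    using X VG assms(6) by (intro generic_affinely_independent[OF gen]) auto
  ultimately obtain \<sigma>1 \<sigma>2 where \<sigma>: "stress d p (edges G1) \<sigma>1" "stress d p (edges G2) \<sigma>2"
    and sum: "\<And>f. \<omega> f = \<sigma>1 f + \<sigma>2 f"
    using stress_split[of "verts G1" "edges G1" "verts G2" "edges G2" d p \<omega>] K assms(3,4)
    unfolding simple_graph_def by metis
  \<comment> \<open>Such a stress lives on edges of \<open>G\<close> and misses the edge
    \<open>f2\<close> of \<open>G\<close>, so \<open>proper\<close> applies.\<close>
  have e1: "c g = 0" if "stress d p (edges G1) c" "c e = 0" for c g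
  proof (rule proper[OF _ f(2)])
    have "stress d p (edges G1 - {e}) c"
      by (rule stress_remove_zero[OF fin(2) that])
    then show "stress d p (edges G) c"
      using EG fin by (intro stress_mono[of "edges G" "edges G1 - {e}"]) auto
    show "c f2 = 0" using that f2 by (auto simp: stress_def)
  qed
  have e2: "c g = 0" if "stress d p (edges G2) c" "c e = 0" for c g
  proof (rule proper[OF _ f(1)])
    have "stress d p (edges G2 - {e}) c"
      by (rule stress_remove_zero[OF fin(3) that])
    then show "stress d p (edges G) c"
      using EG fin by (intro stress_mono[of "edges G" "edges G2 - {e}"]) auto
    show "c f1 = 0" using that f1 by (auto simp: stress_def)
  qed
  \<comment> \<open>At the private edges the nowhere zero \<open>\<omega>\<close> equals a single
    summand, so neither summand is zero, and by \<open>e1\<close> and \<open>e2\<close> neither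
    vanishes at \<open>e\<close>.\<close>
  have "\<sigma>2 f1 = 0" "\<sigma>1 f2 = 0"
    using \<sigma> f1 f2 by (auto simp: stress_def)
  then have "\<sigma>1 f1 \<noteq> 0" "\<sigma>2 f2 \<noteq> 0"
    using nz[OF f(1)] nz[OF f(2)] sum[of f1] sum[of f2] by auto
  then have \<sigma>e: "\<sigma>1 e \<noteq> 0" "\<sigma>2 e \<noteq> 0"
    using e1[OF \<sigma>(1), of f1] e2[OF \<sigma>(2), of f2] by auto
  let ?C1 = "Graph (verts G1) {f. \<sigma>1 f \<noteq> 0}" and ?C2 = "Graph (verts G2) {f. \<sigma>2 f \<noteq> 0}"
  have "unique_R_circuit_in d G1 ?C1"
  proof (rule unique_R_circuit_in_support[OF assms(3) _ gen \<sigma>(1) \<sigma>e(1)])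
    show "c f = 0" if "stress d p (edges G1) c" "c e = 0" for c f
      using that by (rule e1[of c f])
  qed (simp add: VG)
  moreover have "unique_R_circuit_in d G2 ?C2"
  proof (rule unique_R_circuit_in_support[OF assms(4) _ gen \<sigma>(2) \<sigma>e(2)])
    show "c f = 0" if "stress d p (edges G2) c" "c e = 0" for c f
      using that by (rule e2[of c f])
  qed (simp add: VG)
  moreover have "edges G = (edges ?C1 \<union> edges ?C2) - {e}"
  proof
    show "edges G \<subseteq> (edges ?C1 \<union> edges ?C2) - {e}"
    proof
      fix f assume f: "f \<in> edges G"
      with nz[OF f] sum[of f] EG show "f \<in> (edges ?C1 \<union> edges ?C2) - {e}" by auto
    qed
    show "(edges ?C1 \<union> edges ?C2) - {e} \<subseteq> edges G"
      using \<sigma> EG by (auto simp: stress_def)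
  qed
  ultimately show ?thesis
    using \<sigma>e by (intro exI[of _ ?C1] exI[of _ ?C2]) simp
qed

end
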